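(* Let $G$ be a finite simple graph with independence number $\alpha(G)$, and let each edge of $G$ be coloured red or blue. Then there exists a covering set for $G$ consisting of at most $\alpha(G)$ monochromatic subgraphs, each of which has diameter at most $8\alpha(G)^2+12\alpha(G)+4$.
   Context: A 2-colouring of the edges of $G$ assigns each edge one of the two colours red and blue. A monochromatic subgraph is a subgraph of $G$ all of whose edges have the same colour; its diameter is measured within that subgraph (the maximum distance between two of its vertices using only its edges). A set $S$ of monochromatic subgraphs is a covering set for $G$ if $V(G)$ is contained in the union of the vertex sets of the members of $S$. $\alpha(G)$ is the maximum size of an independent set of vertices in $G$. *)

theory Defs
  imports "Graph_Theory.Graph_Theory"
begin

text \<open>
  A finite simple graph is a \<open>pair_graph\<close>: a finite loop-free symmetric digraph whose arcs are
  ordered pairs, an undirected edge $uv$ being the two arcs \<open>(u, v)\<close> and \<open>(v, u)\<close>.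
  An edge colouring is a function on unordered pairs \<open>{u, v}\<close>, so both arcs of an edge get the
  same colour; its values on sets that are not edges are irrelevant.
\<close>

datatype colour = Red | Blue

definition independent_set :: "'a pair_pre_digraph \<Rightarrow> 'a set \<Rightarrow> bool" where
  "independent_set G I \<longleftrightarrow> I \<subseteq> pverts G \<and> (\<forall>u\<in>I. \<forall>v\<in>I. (u, v) \<notin> parcs G)"

definition independence_number :: "'a pair_pre_digraph \<Rightarrow> nat" where
  "independence_number G = Max (card ` {I. independent_set G I})"

text \<open>
  Here \<open>subgraph\<close> is the library's notion for digraphs; \<open>pair_graph H\<close> adds that \<open>H\<close> is itself
  undirected. A subgraph without edges is monochromatic.
\<close>

definition monochromatic_subgraph ::
  "('a set \<Rightarrow> colour) \<Rightarrow> 'a pair_pre_digraph \<Rightarrow> 'a pair_pre_digraph \<Rightarrow> bool" where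
  "monochromatic_subgraph c H G \<longleftrightarrow>
     pair_graph H \<and> subgraph (with_proj H) (with_proj G) \<and>
     (\<exists>k. \<forall>(u, v) \<in> parcs H. c {u, v} = k)"

definition covering_set ::
  "('a set \<Rightarrow> colour) \<Rightarrow> 'a pair_pre_digraph set \<Rightarrow> 'a pair_pre_digraph \<Rightarrow> bool" where
  "covering_set c S G \<longleftrightarrow>
     (\<forall>H\<in>S. monochromatic_subgraph c H G) \<and> pverts G \<subseteq> (\<Union>H\<in>S. pverts H)"

text \<open>
  The distance is the least length of a walk, i.e. the shortest-path cost for unit weights; it is
  \<open>\<infinity>\<close> between vertices that are not connected, so a disconnected graph has diameter \<open>\<infinity>\<close>.
\<close>

definition graph_dist :: "'a pair_pre_digraph \<Rightarrow> 'a \<Rightarrow> 'a \<Rightarrow> ereal" where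
  "graph_dist H u v = wf_digraph.\<mu> (with_proj H) (\<lambda>_. 1) u v"

definition graph_diameter :: "'a pair_pre_digraph \<Rightarrow> ereal" where
  "graph_diameter H = (SUP u\<in>pverts H. SUP v\<in>pverts H. graph_dist H u v)"

end

theory Submission
  imports Defs
begin

text \<open>
  A maximum independent set yields \<open>2\<alpha>\<close> monochromatic stars covering the graph. As long as a cover by
  \<open>t > \<alpha>\<close> monochromatic sets of small diameter is given, \<open>t\<close> can be decreased. If two sets of the
  same colour meet or are joined by an edge of their colour, unite them. Otherwise let \<open>U\<^sub>i\<close> be the
  part of the \<open>i\<close>-th set outside the closed neighbourhoods (each in its own colour) of all the other
  sets. There are no edges between a red \<open>U\<^sub>i\<close> and a blue \<open>U\<^sub>j\<close>, and only blue edges between two red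
  ones, so choosing independent transversals of the red and of the blue \<open>U\<^sub>i\<close> would give \<open>t > \<alpha>\<close>
  independent vertices. Hence, say, the red \<open>U\<^sub>i\<close> have no independent transversal, and Haxell's theorem
  yields a set \<open>S\<close> of red indices and fewer than \<open>|S|\<close> blue edges dominating \<open>U\<^sub>i\<close> for all \<open>i \<in> S\<close>.
  Replace the sets in \<open>S\<close> by the blue double stars at these edges and the other sets by their closed
  neighbourhoods. The sum of the diameters grows by \<open>O(\<alpha>)\<close> in each of the at most \<open>\<alpha>\<close> steps.
\<close>

section \<open>Independent transversals\<close>

definition indep_transversal :: "'a rel \<Rightarrow> ('i \<Rightarrow> 'a set) \<Rightarrow> 'i set \<Rightarrow> ('i \<Rightarrow> 'a) \<Rightarrow> bool" where
  "indep_transversal E V I f \<longleftrightarrow>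
     (\<forall>i\<in>I. f i \<in> V i) \<and> (\<forall>i\<in>I. \<forall>j\<in>I. i \<noteq> j \<longrightarrow> (f i, f j) \<notin> E)"

text \<open>Demanding \<open>r \<in> S\<close> makes the induction work: the merged part must be among the dominated ones
  for the new edge to be paid for.\<close>

lemma no_transversal_imp_dominating_edges_at:
  fixes E :: "'a rel" and V :: "'i \<Rightarrow> 'a set"
  assumes "finite I" "finite E" "sym E" "disjoint_family_on V I" "r \<in> I"
    and "\<nexists>f. indep_transversal E V I f"
    and "indep_transversal E V (I - {r}) f0"
  shows "\<exists>S Z. S \<subseteq> I \<and> r \<in> S \<and> finite Z \<and> Z \<subseteq> E \<and> card Z < card S \<and>
    (\<forall>i\<in>S. V i \<subseteq> E `` Field Z)"
  using assms
proof (induction "card I + card E" arbitrary: I E V f0 rule: less_induct)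
  case less
  note fin = less.prems(1,2) and sym = less.prems(3) and disj = less.prems(4)
    and r = less.prems(5) and noIT = less.prems(6) and f0 = less.prems(7)
  have part_eq: "i = k" if "v \<in> V i" "v \<in> V k" "i \<in> I" "k \<in> I" for v i k
    using disj that unfolding disjoint_family_on_def by blast
  show ?case
  proof (cases "V r = {}")
    case True
    then show ?thesis using r by (intro exI[of _ "{r}"] exI[of _ "{}"]) auto
  next
    case False
    then obtain x where x: "x \<in> V r" by blast
    \<comment> \<open>If \<open>x\<close> had no neighbour, it would extend \<open>f0\<close> to a
      transversal of all parts.\<close>
    obtain y where xy: "(x, y) \<in> E"
    proof (rule ccontr)
      assume "\<not> thesis"
      then have "\<And>z. (x, z) \<notin> E" "\<And>z. (z, x) \<notin> E"
        using that sym by (blast dest: symD)+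
      then have "indep_transversal E V I (f0(r := x))"
        using f0 x unfolding indep_transversal_def by auto
      then show False using noIT by blast
    qed
    have yx: "(y, x) \<in> E" using xy sym by (blast dest: symD)
    \<comment> \<open>Without the edge \<open>xy\<close> there is either still no transversal, and
      the induction applies to fewer edges, or there is one, and as it fails for \<open>E\<close> it
      contains both \<open>x\<close> and \<open>y\<close>.\<close>
    let ?E = "E - {(x, y), (y, x)}"
    show ?thesis
    proof (cases "\<exists>f. indep_transversal ?E V I f")
      case False
      have "card ?E < card E" using fin xy by (intro psubset_card_mono) auto
      moreover have "sym ?E" using sym unfolding sym_def by auto
      moreover have "indep_transversal ?E V (I - {r}) f0"
        using f0 unfolding indep_transversal_def by blast
      ultimately obtain S Z where
        "S \<subseteq> I" "r \<in> S" "finite Z" "Z \<subseteq> ?E" "card Z < card S" "\<forall>i\<in>S. V i \<subseteq> ?E `` Field Z"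
        using less.hyps[of I ?E V f0] fin disj r False by auto
      then show ?thesis by (intro exI[of _ S] exI[of _ Z]) blast
    next
      case True
      then obtain f where f: "indep_transversal ?E V I f" by blast
      obtain j where j: "j \<in> I" "j \<noteq> r" "f j = y" and fr: "f r = x"
      proof -
        obtain i k where ik: "i \<in> I" "k \<in> I" "i \<noteq> k" "(f i, f k) \<in> E"
          using f noIT unfolding indep_transversal_def by blast
        then have "(f i, f k) \<in> {(x, y), (y, x)}"
          using f unfolding indep_transversal_def by blast
        then consider "f i = x" "f k = y" | "f i = y" "f k = x" by auto
        then show thesis
        proof cases
          case 1
          then have "i = r" using ik f x r part_eq unfolding indep_transversal_def by blast
          with 1 ik that show thesis by blast
        next
          case 2
          then have "k = r" using ik f x r part_eq unfolding indep_transversal_def by blast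
          with 2 ik that show thesis by blast
        qed
      qed
      have fI: "f i \<in> V i" if "i \<in> I" for i
        using f that unfolding indep_transversal_def by blast
      have f_neq: "f i \<noteq> x" "f i \<noteq> y" if "i \<in> I" "i \<noteq> j" "i \<noteq> r" for i
        using part_eq[of x i r] part_eq[of y i j] fI[of i] fI[of j] x r j that by auto
      have fE: "(f i, f k) \<notin> ?E" if "i \<in> I" "k \<in> I" "i \<noteq> k" for i k
        using f that unfolding indep_transversal_def by blast
      \<comment> \<open>Delete the neighbours of \<open>x\<close> and \<open>y\<close> and merge the parts of \<open>x\<close> and \<open>y\<close>: a transversal of
        the result extends by \<open>x\<close> or \<open>y\<close>, whichever part it misses.\<close>
      define N where "N = E `` {x, y}"
      define W where "W = (\<lambda>i. (if i = r then V r \<union> V j else V i) - N)"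
      let ?I = "I - {j}"
      have nbr: "(v, x) \<in> E \<longleftrightarrow> (x, v) \<in> E" "(v, y) \<in> E \<longleftrightarrow> (y, v) \<in> E" for v
        using sym by (blast dest: symD)+
      have "\<not> indep_transversal E W ?I g" for g
      proof
        assume g: "indep_transversal E W ?I g"
        have gW: "g i \<in> W i" if "i \<in> ?I" for i
          using g that unfolding indep_transversal_def by blast
        have gE: "(g i, g k) \<notin> E" if "i \<in> ?I" "k \<in> ?I" "i \<noteq> k" for i k
          using g that unfolding indep_transversal_def by blast
        have gN: "g i \<notin> N" if "i \<in> ?I" for i using gW[OF that] unfolding W_def by auto
        have gV: "g i \<in> V i" if "i \<in> ?I" "i \<noteq> r" for i
          using gW[OF that(1)] that(2) unfolding W_def by auto
        have "g r \<in> V r \<or> g r \<in> V j" using gW[of r] r j unfolding W_def by auto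
        then show False
        proof
          assume "g r \<in> V r"
          then have "\<forall>i\<in>I. (g(j := y)) i \<in> V i" using gV fI[OF j(1)] j(3) by auto
          moreover have "\<forall>i\<in>I. \<forall>k\<in>I. i \<noteq> k \<longrightarrow> ((g(j := y)) i, (g(j := y)) k) \<notin> E"
            using gE gN nbr unfolding N_def by auto
          ultimately show False using noIT unfolding indep_transversal_def by blast
        next
          assume gr: "g r \<in> V j"
          let ?g = "g(j := g r, r := x)"
          have "\<forall>i\<in>I. ?g i \<in> V i" using gV gr x by auto
          moreover have "\<forall>i\<in>I. \<forall>k\<in>I. i \<noteq> k \<longrightarrow> (?g i, ?g k) \<notin> E"
            using gE gN nbr r j(2) unfolding N_def by auto
          ultimately show False using noIT unfolding indep_transversal_def by blast
        qed
      qed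
      \<comment> \<open>\<open>f\<close> contains \<open>x\<close> and \<open>y\<close>, so its
        independence in \<open>?E\<close> keeps its other vertices out of \<open>N\<close>.\<close>
      moreover have "indep_transversal E W (?I - {r}) f"
      proof -
        have "f i \<in> W i" if "i \<in> ?I - {r}" for i
        proof -
          have i: "i \<in> I" "i \<noteq> j" "i \<noteq> r" using that by auto
          have "(x, f i) \<notin> E" "(y, f i) \<notin> E"
            using f_neq[OF i] fE[OF r i(1)] fE[OF j(1) i(1)] i fr j(3) by auto
          then show ?thesis using fI[OF i(1)] i unfolding W_def N_def by auto
        qed
        moreover have "(f i, f k) \<notin> E" if "i \<in> ?I - {r}" "k \<in> ?I - {r}" "i \<noteq> k" for i k
          using f_neq[of i] fE[of i k] that by auto
        ultimately show ?thesis unfolding indep_transversal_def by blast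
      qed
      moreover have "card ?I < card I" using fin j by (intro psubset_card_mono) auto
      moreover have "disjoint_family_on W ?I"
      proof -
        have "i = k" if v: "v \<in> W i" "v \<in> W k" and ik: "i \<in> ?I" "k \<in> ?I" for v i k
        proof -
          obtain i' where "v \<in> V i'" "i' \<in> I" "i' = i \<or> i' = j \<and> i = r"
            using v(1) ik(1) j(1) unfolding W_def by (auto split: if_splits)
          moreover obtain k' where "v \<in> V k'" "k' \<in> I" "k' = k \<or> k' = j \<and> k = r"
            using v(2) ik(2) j(1) unfolding W_def by (auto split: if_splits)
          ultimately show ?thesis using part_eq[of v i' k'] ik by auto
        qed
        then show ?thesis unfolding disjoint_family_on_def by blast
      qed
      ultimately obtain S Z where
        S: "S \<subseteq> ?I" "r \<in> S" and Z: "finite Z" "Z \<subseteq> E" "card Z < card S"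
        and dom: "\<forall>i\<in>S. W i \<subseteq> E `` Field Z"
        using less.hyps[of ?I E W f] fin sym r j by auto
      have "finite S" using S fin finite_subset by blast
      \<comment> \<open>The new index \<open>j\<close> pays for the new edge. As
        \<open>r \<in> S\<close> and part \<open>r\<close> of \<open>W\<close> contains what remains
        of \<open>V j\<close>, all of \<open>V j\<close> is dominated: its vertices in
        \<open>N\<close> by the new edge, the others by \<open>Z\<close>.\<close>
      then have "card (insert (x, y) Z) < card (insert j S)"
        using S Z by (auto simp: card_insert_if)
      moreover have "V i \<subseteq> E `` Field (insert (x, y) Z)" if "i \<in> insert j S" for i
      proof
        fix v assume v: "v \<in> V i"
        show "v \<in> E `` Field (insert (x, y) Z)"
        proof (cases "v \<in> N")
          case True
          then show ?thesis unfolding N_def Field_def by auto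
        next
          case False
          then have "v \<in> W (if i = j then r else i)" using v unfolding W_def by auto
          then have "v \<in> E `` Field Z" using dom that S by (auto split: if_splits)
          then show ?thesis unfolding Field_def by auto
        qed
      qed
      ultimately show ?thesis using S Z xy j
        by (intro exI[of _ "insert j S"] exI[of _ "insert (x, y) Z"]) auto
    qed
  qed
qed

text \<open>Haxell's theorem. A largest \<open>J\<close> with an independent transversal misses some
  \<open>r\<close>; then \<open>insert r J\<close> has no transversal but has one after removing
  \<open>r\<close>, as the induction above requires.\<close>

lemma no_transversal_imp_dominating_edges:
  fixes E :: "'a rel" and V :: "'i \<Rightarrow> 'a set"
  assumes "finite I" "finite E" "sym E" "disjoint_family_on V I"
    and noIT: "\<nexists>f. indep_transversal E V I f"
  obtains S Z where "S \<subseteq> I" "finite Z" "Z \<subseteq> E" "card Z < card S"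
    "\<And>i. i \<in> S \<Longrightarrow> V i \<subseteq> E `` Field Z"
proof -
  define P where "P = (\<lambda>J. J \<subseteq> I \<and> (\<exists>f. indep_transversal E V J f))"
  have "P {}" by (simp add: P_def indep_transversal_def)
  moreover have "\<forall>J. P J \<longrightarrow> card J < Suc (card I)"
    using assms(1) by (simp add: P_def card_mono less_Suc_eq_le)
  ultimately have "\<exists>J. P J \<and> (\<forall>K. P K \<longrightarrow> card K \<le> card J)"
    by (rule ex_has_greatest_nat)
  then obtain J where "P J" and max: "\<And>K. P K \<Longrightarrow> card K \<le> card J" by blast
  then have J: "J \<subseteq> I" "\<exists>f. indep_transversal E V J f" by (auto simp: P_def)
  then have "J \<noteq> I" using noIT by auto
  then obtain r where r: "r \<in> I" "r \<notin> J" using J(1) by blast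
  have "finite J" using J(1) assms(1) by (rule finite_subset)
  then have "\<nexists>f. indep_transversal E V (insert r J) f"
    using max[of "insert r J"] J r by (auto simp: P_def)
  moreover obtain f where "indep_transversal E V (insert r J - {r}) f" using J r by auto
  moreover have "disjoint_family_on V (insert r J)"
    using assms(4) J r by (auto intro: disjoint_family_on_mono)
  ultimately obtain S Z where "S \<subseteq> insert r J" "finite Z" "Z \<subseteq> E" "card Z < card S"
      "\<forall>i\<in>S. V i \<subseteq> E `` Field Z"
    using no_transversal_imp_dominating_edges_at[of "insert r J" E V r f] \<open>finite J\<close> assms(2,3)
    by auto
  then show thesis using that[of S Z] J r by blast
qed

section \<open>Sets of bounded diameter\<close>

text \<open>Intersecting with \<open>D \<times> D\<close> keeps the paths inside \<open>D\<close>,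
  since diameters are measured within the subgraph.\<close>

definition diam_le :: "'a rel \<Rightarrow> 'a set \<Rightarrow> nat \<Rightarrow> bool" where
  "diam_le E D d \<longleftrightarrow> (\<forall>u\<in>D. \<forall>v\<in>D. \<exists>n\<le>d. (u, v) \<in> (E \<inter> D \<times> D) ^^ n)"

definition nbhd :: "'a rel \<Rightarrow> 'a set \<Rightarrow> 'a set" where
  "nbhd E D = D \<union> E `` D"

lemma relpow_mono:
  fixes R S :: "'a rel"
  assumes "R \<subseteq> S"
  shows "R ^^ n \<subseteq> S ^^ n"
  using assms by (induction n) auto

lemma diam_le_singleton: "diam_le E {x} 0"
  unfolding diam_le_def by auto

lemma diam_le_edge:
  assumes "sym E" "(x, y) \<in> E"
  shows "diam_le E {x, y} 1"
proof -
  have "(y, x) \<in> E" using assms by (blast dest: symD)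
  have "\<exists>n\<le>1. (u, v) \<in> (E \<inter> {x, y} \<times> {x, y}) ^^ n" if "u \<in> {x, y}" "v \<in> {x, y}" for u v
  proof (cases "u = v")
    case True
    then show ?thesis by (intro exI[of _ 0]) auto
  next
    case False
    then show ?thesis using that assms \<open>(y, x) \<in> E\<close> by (intro exI[of _ 1]) auto
  qed
  then show ?thesis unfolding diam_le_def by blast
qed

text \<open>Each point of the closed neighbourhood is at most one step away from \<open>D\<close>,
  which costs one step at either end of a path.\<close>

lemma diam_le_nbhd:
  assumes "sym E" "diam_le E D d"
  shows "diam_le E (nbhd E D) (d + 2)"
proof -
  let ?N = "nbhd E D"
  let ?R = "E \<inter> ?N \<times> ?N"
  have out: "\<exists>w\<in>D. \<exists>n\<le>1. (w, u) \<in> ?R ^^ n \<and> (u, w) \<in> ?R ^^ n" if "u \<in> ?N" for u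
  proof (cases "u \<in> D")
    case True
    then show ?thesis by (intro bexI[of _ u] exI[of _ 0]) auto
  next
    case False
    then obtain w where "w \<in> D" "(w, u) \<in> E" using \<open>u \<in> ?N\<close> unfolding nbhd_def by blast
    moreover from this have "(u, w) \<in> E" using assms(1) by (blast dest: symD)
    ultimately show ?thesis using that
      by (intro bexI[of _ w] exI[of _ 1]) (auto simp: nbhd_def)
  qed
  have "\<exists>n\<le>d + 2. (u, v) \<in> ?R ^^ n" if uv: "u \<in> ?N" "v \<in> ?N" for u v
  proof -
    obtain u' m where u': "u' \<in> D" "m \<le> 1" "(u, u') \<in> ?R ^^ m" using out[OF uv(1)] by blast
    obtain v' l where v': "v' \<in> D" "l \<le> 1" "(v', v) \<in> ?R ^^ l" using out[OF uv(2)] by blast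
    obtain n where n: "n \<le> d" "(u', v') \<in> (E \<inter> D \<times> D) ^^ n"
      using assms(2) u' v' unfolding diam_le_def by blast
    have "(u', v') \<in> ?R ^^ n"
      using n(2) relpow_mono[of "E \<inter> D \<times> D" ?R n] unfolding nbhd_def by blast
    then have "(u, v) \<in> ?R ^^ (m + n + l)" using u' v' unfolding relpow_add by blast
    then show ?thesis using n u' v' by (intro exI[of _ "m + n + l"]) auto
  qed
  then show ?thesis unfolding diam_le_def by blast
qed

text \<open>Some \<open>x\<close> in \<open>C\<close> and \<open>y\<close> in \<open>D\<close>
  coincide or are adjacent, so crossing from one set to the other costs at most one step.\<close>

lemma diam_le_Un:
  assumes "sym E" "diam_le E C c" "diam_le E D d" "C \<inter> nbhd E D \<noteq> {}"
  shows "diam_le E (C \<union> D) (c + d + 1)"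
proof -
  let ?R = "E \<inter> (C \<union> D) \<times> (C \<union> D)"
  obtain x y where xy: "x \<in> C" "y \<in> D" "x = y \<or> (y, x) \<in> E"
    using assms(4) unfolding nbhd_def by blast
  obtain s where s: "s \<le> 1" "(x, y) \<in> ?R ^^ s" "(y, x) \<in> ?R ^^ s"
  proof (cases "x = y")
    case True
    then show thesis using that[of 0] by auto
  next
    case False
    then have "(y, x) \<in> E" "(x, y) \<in> E" using xy assms(1) by (blast dest: symD)+
    then show thesis using that[of 1] xy by auto
  qed
  have C: "\<exists>n\<le>c. (u, v) \<in> ?R ^^ n" if "u \<in> C" "v \<in> C" for u v
    using assms(2) that relpow_mono[of "E \<inter> C \<times> C" ?R] unfolding diam_le_def by blast
  have D: "\<exists>n\<le>d. (u, v) \<in> ?R ^^ n" if "u \<in> D" "v \<in> D" for u v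
    using assms(3) that relpow_mono[of "E \<inter> D \<times> D" ?R] unfolding diam_le_def by blast
  have join: "\<exists>n\<le>c + d + 1. (u, v) \<in> ?R ^^ n"
    if up: "\<exists>n\<le>a. (u, p) \<in> ?R ^^ n" and pq: "(p, q) \<in> ?R ^^ s"
      and qv: "\<exists>n\<le>b. (q, v) \<in> ?R ^^ n" and ab: "a + b = c + d"
    for u v p q a b
  proof -
    obtain m n where mn: "m \<le> a" "n \<le> b" and uv: "(u, p) \<in> ?R ^^ m" "(q, v) \<in> ?R ^^ n"
      using up qv by blast
    have "(u, v) \<in> ?R ^^ (m + s + n)" using uv pq unfolding relpow_add by blast
    then show ?thesis using mn ab s(1) by (intro exI[of _ "m + s + n"]) auto
  qed
  have "\<exists>n\<le>c + d + 1. (u, v) \<in> ?R ^^ n" if uv: "u \<in> C \<union> D" "v \<in> C \<union> D" for u v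
  proof -
    consider "u \<in> C" "v \<in> C" | "u \<in> D" "v \<in> D" | "u \<in> C" "v \<in> D" | "u \<in> D" "v \<in> C"
      using uv by blast
    then show ?thesis
    proof cases
      case 1
      from C[OF this] obtain n where "n \<le> c" "(u, v) \<in> ?R ^^ n" by blast
      then show ?thesis by (intro exI[of _ n]) auto
    next
      case 2
      from D[OF this] obtain n where "n \<le> d" "(u, v) \<in> ?R ^^ n" by blast
      then show ?thesis by (intro exI[of _ n]) auto
    next
      case 3
      show ?thesis by (rule join[OF C[OF 3(1) xy(1)] s(2) D[OF xy(2) 3(2)]]) simp
    next
      case 4
      show ?thesis by (rule join[OF D[OF 4(1) xy(2)] s(3) C[OF xy(1) 4(2)]]) simp
    qed
  qed
  then show ?thesis unfolding diam_le_def by blast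
qed

section \<open>Covers by monochromatic sets\<close>

fun other :: "colour \<Rightarrow> colour" where
  "other Red = Blue"
| "other Blue = Red"

lemma neq_imp_other: "l \<noteq> k \<Longrightarrow> l = other k"
  by (cases k; cases l) auto

text \<open>With one relation per colour, neighbourhoods and transversals can be taken in a single
  colour, and the digraph library is kept out of the combinatorics.\<close>

locale coloured_graph =
  fixes V :: "'a set" and E :: "colour \<Rightarrow> 'a rel"
  assumes finite_V: "finite V"
    and E_subset: "E k \<subseteq> V \<times> V"
    and sym_E: "sym (E k)"
    and irrefl_E: "(x, x) \<notin> E k"
begin

text \<open>A triple \<open>(k, D, d)\<close> stands for a set \<open>D\<close> of diameter at most \<open>d\<close> in colour \<open>k\<close>.\<close>

definition cover :: "(colour \<times> 'a set \<times> nat) set \<Rightarrow> bool" where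
  "cover F \<longleftrightarrow> finite F \<and> (\<forall>(k, D, d)\<in>F. D \<subseteq> V \<and> diam_le (E k) D d) \<and>
     V \<subseteq> (\<Union>(k, D, d)\<in>F. D)"

text \<open>With the summand \<open>1\<close>, uniting two sets joined by an edge does not change the weight.\<close>

definition weight :: "(colour \<times> 'a set \<times> nat) set \<Rightarrow> nat" where
  "weight F = (\<Sum>(k, D, d)\<in>F. d + 1)"

definition indep :: "'a set \<Rightarrow> bool" where
  "indep X \<longleftrightarrow> X \<subseteq> V \<and> (\<forall>u\<in>X. \<forall>v\<in>X. \<forall>k. (u, v) \<notin> E k)"

lemma coverD:
  assumes "cover F"
  shows "finite F" and "(k, D, d) \<in> F \<Longrightarrow> D \<subseteq> V" and "(k, D, d) \<in> F \<Longrightarrow> diam_le (E k) D d"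
    and "v \<in> V \<Longrightarrow> \<exists>(k, D, d)\<in>F. v \<in> D"
  using assms unfolding cover_def by blast+

lemma coverI:
  assumes "finite F" and "\<And>k D d. (k, D, d) \<in> F \<Longrightarrow> D \<subseteq> V \<and> diam_le (E k) D d"
    and "\<And>v. v \<in> V \<Longrightarrow> \<exists>(k, D, d)\<in>F. v \<in> D"
  shows "cover F"
  using assms unfolding cover_def by fast

lemma nbhd_subset_V: "D \<subseteq> V \<Longrightarrow> nbhd (E k) D \<subseteq> V"
  using E_subset[of k] unfolding nbhd_def by auto

lemma finite_E: "finite (E k)"
  using finite_V E_subset[of k] finite_subset by blast

lemma weight_Un_le: "finite F \<Longrightarrow> finite H \<Longrightarrow> weight (F \<union> H) \<le> weight F + weight H"
  unfolding weight_def by (subst sum.union_inter[symmetric]) auto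

lemma weight_image_le:
  assumes "finite A"
  shows "weight ((\<lambda>a. (k a, D a, d a)) ` A) \<le> (\<Sum>a\<in>A. d a + 1)"
  unfolding weight_def using sum_image_le[OF assms, of "\<lambda>(k, D, d). d + 1" "\<lambda>a. (k a, D a, d a)"]
  by (simp add: o_def)

section \<open>Reducing the number of sets in a cover\<close>

lemma shrink_by_merging:
  assumes F: "cover F" and in_F: "(k, C, c) \<in> F" "(k, D, d) \<in> F"
    and ne: "(k, C, c) \<noteq> (k, D, d)" and meet: "C \<inter> nbhd (E k) D \<noteq> {}"
  shows "\<exists>F'. cover F' \<and> card F' < card F \<and> weight F' \<le> weight F"
proof (intro exI conjI)
  let ?R = "F - {(k, C, c), (k, D, d)}"
  let ?F' = "?R \<union> {(k, C \<union> D, c + d + 1)}"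
  show "cover ?F'"
  proof (rule coverI)
    show "finite ?F'" using coverD(1)[OF F] by blast
    have "C \<union> D \<subseteq> V" "diam_le (E k) (C \<union> D) (c + d + 1)"
      using coverD(2,3)[OF F in_F(1)] coverD(2,3)[OF F in_F(2)] diam_le_Un[OF sym_E _ _ meet]
      by auto
    then show "B \<subseteq> V \<and> diam_le (E l) B b" if "(l, B, b) \<in> ?F'" for l B b
      using that coverD(2,3)[OF F, of l B b] by auto
    show "\<exists>(l, B, b)\<in>?F'. v \<in> B" if v: "v \<in> V" for v
    proof -
      obtain l B b where "(l, B, b) \<in> F" "v \<in> B" using coverD(4)[OF F v] by blast
      then show ?thesis by (cases "(l, B, b) \<in> ?R") auto
    qed
  qed
  have FR: "F = insert (k, C, c) (insert (k, D, d) ?R)" using in_F by blast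
  have fin: "finite ?R" using coverD(1)[OF F] by blast
  have "card F = card ?R + 2" by (subst FR) (use fin ne in auto)
  then show "card ?F' < card F" using fin by (auto simp: card_insert_if)
  have "weight F = weight ?R + (c + 1) + (d + 1)"
    unfolding weight_def by (subst FR) (use fin ne in auto)
  \<comment> \<open>Of the two summands \<open>1\<close> of the old members, one pays for the step
    between them and the other is the summand of the new member.\<close>
  moreover have "weight {(k, C \<union> D, c + d + 1)} = (c + 1) + (d + 1)" unfolding weight_def by simp
  ultimately show "weight ?F' \<le> weight F"
    using weight_Un_le[OF fin, of "{(k, C \<union> D, c + d + 1)}"] by simp
qed

text \<open>The members in \<open>S\<close> give way to fewer double stars of the other colour, and
  all other members grow to their closed neighbourhoods. A vertex of a discarded member is covered
  by a double star unless it is close to another member, which \<open>apart\<close> shows to be a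
  kept one.\<close>

lemma shrink_by_exchange:
  assumes F: "cover F" and S: "S \<subseteq> F" "\<And>i. i \<in> S \<Longrightarrow> fst i = k"
    and Z: "finite Z" "Z \<subseteq> E (other k)" "card Z < card S"
    and apart: "\<And>C c D d. (k, C, c) \<in> F \<Longrightarrow> (k, D, d) \<in> F \<Longrightarrow> (k, C, c) \<noteq> (k, D, d) \<Longrightarrow>
      C \<inter> nbhd (E k) D = {}"
    and dom: "\<And>C c. (k, C, c) \<in> S \<Longrightarrow>
      C - (\<Union>(l, D, d)\<in>F - {(k, C, c)}. nbhd (E l) D) \<subseteq> E (other k) `` Field Z"
  shows "\<exists>F'. cover F' \<and> card F' < card F \<and> weight F' \<le> weight F + 4 * card F"
proof (intro exI conjI)
  let ?A = "(\<lambda>i. (fst i, nbhd (E (fst i)) (fst (snd i)), snd (snd i) + 2)) ` (F - S)"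
  \<comment> \<open>The \<open>3\<close> is the diameter bound \<open>1\<close> of an edge plus
    \<open>2\<close> for its closed neighbourhood.\<close>
  let ?B = "(\<lambda>e. (other k, nbhd (E (other k)) {fst e, snd e}, 3::nat)) ` Z"
  have finF: "finite F" and finS: "finite S" using coverD(1)[OF F] S(1) finite_subset by blast+
  have A: "D \<subseteq> V \<and> diam_le (E l) D d" if mem: "(l, D, d) \<in> ?A" for l D d
  proof -
    obtain C c where "(l, C, c) \<in> F" "D = nbhd (E l) C" "d = c + 2" using mem by auto
    then show ?thesis
      using coverD(2,3)[OF F, of l C c] nbhd_subset_V diam_le_nbhd[OF sym_E] by simp
  qed
  have B: "D \<subseteq> V \<and> diam_le (E l) D d" if mem: "(l, D, d) \<in> ?B" for l D d
  proof -
    obtain x y where "(x, y) \<in> Z" and D: "l = other k" "D = nbhd (E l) {x, y}" "d = 3"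
      using mem by auto
    then have xy: "(x, y) \<in> E l" using Z(2) by blast
    then have "{x, y} \<subseteq> V" using E_subset[of l] by blast
    then show ?thesis
      using D nbhd_subset_V diam_le_nbhd[OF sym_E diam_le_edge[OF sym_E xy]]
      by (simp add: eval_nat_numeral)
  qed
  have covered: "\<exists>(l, D, d)\<in>?A \<union> ?B. v \<in> D" if v: "v \<in> V" for v
  proof -
    have outside: ?thesis if "(l, D, d) \<in> F - S" "v \<in> nbhd (E l) D" for l D d
      using that by (intro bexI[of _ "(l, nbhd (E l) D, d + 2)"]) force+
    obtain l C c where C: "(l, C, c) \<in> F" "v \<in> C" using coverD(4)[OF F v] by blast
    show ?thesis
    proof (cases "(l, C, c) \<in> S")
      case False
      then show ?thesis using outside[of l C c] C unfolding nbhd_def by blast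
    next
      case True
      then have l: "l = k" using S(2) by fastforce
      show ?thesis
      proof (cases "v \<in> (\<Union>(l, D, d)\<in>F - {(k, C, c)}. nbhd (E l) D)")
        case vD: True
        then obtain l' D d where D: "(l', D, d) \<in> F" "(l', D, d) \<noteq> (k, C, c)" "v \<in> nbhd (E l') D"
          by blast
        \<comment> \<open>All members of \<open>S\<close> have colour \<open>k\<close>, and by
          \<open>apart\<close> no other member of that colour has \<open>v\<close> in its
          neighbourhood.\<close>
        have "(l', D, d) \<notin> S"
        proof
          assume "(l', D, d) \<in> S"
          then have "l' = k" using S(2) by fastforce
          then show False using apart[of C c D d] C D l by blast
        qed
        then show ?thesis using outside D by blast
      next
        case False
        then have "v \<in> E (other k) `` Field Z" using dom[of C c] True C l by blast
        then obtain x y where "(x, y) \<in> Z" "v \<in> nbhd (E (other k)) {x, y}"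
          unfolding Field_def nbhd_def by blast
        then show ?thesis
          by (intro bexI[of _ "(other k, nbhd (E (other k)) {x, y}, 3)"]) force+
      qed
    qed
  qed
  show "cover (?A \<union> ?B)"
  proof (rule coverI[OF _ _ covered])
    show "finite (?A \<union> ?B)" using finF Z(1) by blast
    show "D \<subseteq> V \<and> diam_le (E l) D d" if "(l, D, d) \<in> ?A \<union> ?B" for l D d
      using A[of l D d] B[of l D d] that by (simp only: Un_iff) blast
  qed
  have cS: "card (F - S) + card S = card F"
    using S(1) finF finS by (simp add: card_Diff_subset card_mono)
  have "card (?A \<union> ?B) \<le> card (F - S) + card Z"
    using card_Un_le[of ?A ?B] card_image_le[of "F - S"] card_image_le[of Z] finF Z(1)
    by (meson add_mono finite_Diff order_trans)
  then show "card (?A \<union> ?B) < card F" using cS Z(3) by linarith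
  have "weight ?A \<le> (\<Sum>i\<in>F - S. snd (snd i) + 2 + 1)"
    by (rule weight_image_le) (use finF in blast)
  also have "\<dots> = (\<Sum>i\<in>F - S. snd (snd i) + 1) + 2 * card (F - S)"
    unfolding sum.distrib sum_constant by simp
  also have "(\<Sum>i\<in>F - S. snd (snd i) + 1) \<le> weight F"
    unfolding weight_def case_prod_beta by (rule sum_mono2) (use finF in auto)
  finally have "weight ?A \<le> weight F + 2 * card (F - S)" by simp
  moreover have "weight ?B \<le> 4 * card Z"
    using weight_image_le[OF Z(1), of "\<lambda>_. other k" _ "\<lambda>_. 3"] by (simp add: mult.commute)
  moreover have "weight (?A \<union> ?B) \<le> weight ?A + weight ?B"
    by (rule weight_Un_le) (use finF Z(1) in auto)
  \<comment> \<open>Each kept member adds \<open>2\<close> and each double star weighs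
    \<open>3 + 1\<close>; there are fewer double stars than discarded members, so \<open>4\<close>
    per old member suffices.\<close>
  ultimately show "weight (?A \<union> ?B) \<le> weight F + 4 * card F"
    using cS Z(3) by linarith
qed

lemma shrink_cover:
  assumes F: "cover F" and large: "\<And>X. indep X \<Longrightarrow> card X < card F"
  shows "\<exists>F'. cover F' \<and> card F' < card F \<and> weight F' \<le> weight F + 4 * card F"
proof (cases "\<exists>k C c D d. (k, C, c) \<in> F \<and> (k, D, d) \<in> F \<and> (k, C, c) \<noteq> (k, D, d) \<and>
    C \<inter> nbhd (E k) D \<noteq> {}")
  case True
  then show ?thesis using shrink_by_merging[OF F] by (meson trans_le_add1)
next
  case apart: False
  define U where "U = (\<lambda>i. fst (snd i) - (\<Union>(l, D, d)\<in>F - {i}. nbhd (E l) D))"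
  have U_sub: "U (k, C, c) \<subseteq> C" for k C c unfolding U_def by auto
  have U_avoid: "U i \<inter> nbhd (E l) D = {}" if "(l, D, d) \<in> F" "i \<noteq> (l, D, d)" for i l D d
    using that unfolding U_def by fastforce
  \<comment> \<open>Used in both orders of \<open>i\<close> and \<open>j\<close>, this excludes
    edges in the colour of either member. What can remain are edges of the other colour between two
    members of equal colour.\<close>
  have U_nbhd: "(u, v) \<notin> E (fst i)" "u \<noteq> v" "(v, u) \<notin> E (fst i)"
    if ij: "i \<in> F" "i \<noteq> j" and uv: "u \<in> U i" "v \<in> U j" for i j u v
  proof -
    obtain k C c where i: "i = (k, C, c)" by (cases i)
    have "u \<in> C" "v \<notin> nbhd (E k) C" using U_sub U_avoid[of k C c j] i ij uv by blast+
    then show "(u, v) \<notin> E (fst i)" "u \<noteq> v" unfolding nbhd_def i by auto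
    then show "(v, u) \<notin> E (fst i)" using sym_E by (blast dest: symD)
  qed
  have "disjoint_family_on U F" unfolding disjoint_family_on_def using U_nbhd(2) by blast
  define Fk where "Fk = (\<lambda>k. {i\<in>F. fst i = k})"
  \<comment> \<open>Transversals for both colours would combine to an independent set with one
    vertex per member, contradicting \<open>large\<close>.\<close>
  have "\<exists>k. \<nexists>f. indep_transversal (E (other k)) U (Fk k) f"
  proof (rule ccontr)
    assume "\<not> ?thesis"
    then obtain f where f: "\<And>k. indep_transversal (E (other k)) U (Fk k) (f k)" by metis
    define g where "g = (\<lambda>i. f (fst i) i)"
    have gU: "g i \<in> U i" if "i \<in> F" for i
      using f[of "fst i"] that unfolding indep_transversal_def g_def Fk_def by blast
    have gE: "(g i, g j) \<notin> E k" if ij: "i \<in> F" "j \<in> F" for i j k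
    proof (cases "i = j")
      case True
      then show ?thesis using irrefl_E by simp
    next
      case False
      show ?thesis
      proof (cases "fst i = k \<or> fst j = k")
        case True
        then show ?thesis using U_nbhd(1)[OF ij(1) False gU gU] U_nbhd(3)[of j i "g j" "g i"] gU ij False
          by metis
      next
        case notk: False
        \<comment> \<open>This is the only kind of edge that the choice of transversals has to
          exclude.\<close>
        then have "fst j = fst i" "k = other (fst i)"
          using neq_imp_other[of "fst i" k] neq_imp_other[of "fst j" k] neq_imp_other[of k "fst i"]
          by auto
        moreover from this have "i \<in> Fk (fst i)" "j \<in> Fk (fst i)" using ij unfolding Fk_def by auto
        ultimately show ?thesis using f[of "fst i"] False
          unfolding indep_transversal_def g_def by metis
      qed
    qed
    have "g ` F \<subseteq> V"
    proof
      fix v assume "v \<in> g ` F"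
      then obtain k C c where "(k, C, c) \<in> F" "v = g (k, C, c)" by auto
      then show "v \<in> V" using gU U_sub coverD(2)[OF F] by blast
    qed
    then have "indep (g ` F)" using gE unfolding indep_def by blast
    moreover have "inj_on g F" using gU U_nbhd(2) unfolding inj_on_def by metis
    ultimately show False using large[of "g ` F"] by (simp add: card_image)
  qed
  then obtain k where k: "\<nexists>f. indep_transversal (E (other k)) U (Fk k) f" by blast
  have "finite (Fk k)" "disjoint_family_on U (Fk k)"
    using coverD(1)[OF F] \<open>disjoint_family_on U F\<close> unfolding Fk_def
    by (auto intro: disjoint_family_on_mono[rotated])
  then obtain S Z where S: "S \<subseteq> Fk k" and Z: "finite Z" "Z \<subseteq> E (other k)" "card Z < card S"
    and dom: "\<And>i. i \<in> S \<Longrightarrow> U i \<subseteq> E (other k) `` Field Z"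
    using no_transversal_imp_dominating_edges[OF _ finite_E sym_E _ k] by blast
  show ?thesis
  proof (rule shrink_by_exchange[OF F _ _ Z])
    show "S \<subseteq> F" "\<And>i. i \<in> S \<Longrightarrow> fst i = k" using S unfolding Fk_def by auto
    show "C \<inter> nbhd (E k) D = {}" if "(k, C, c) \<in> F" "(k, D, d) \<in> F" "(k, C, c) \<noteq> (k, D, d)"
      for C c D d using apart that by blast
    show "C - (\<Union>(l, D, d)\<in>F - {(k, C, c)}. nbhd (E l) D) \<subseteq> E (other k) `` Field Z"
      if "(k, C, c) \<in> S" for C c using dom[OF that] unfolding U_def by simp
  qed
qed

section \<open>Iterating the reduction, starting from stars\<close>

lemma shrink_cover_to:
  assumes "\<And>X. indep X \<Longrightarrow> card X \<le> a" and "cover F" and "card F \<le> 2 * a"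
  shows "\<exists>F'. cover F' \<and> card F' \<le> a \<and> weight F' \<le> weight F + 8 * a * (card F - a)"
  using assms(2,3)
proof (induction "card F" arbitrary: F rule: less_induct)
  case less
  show ?case
  proof (cases "card F \<le> a")
    case True
    then show ?thesis using less.prems by (intro exI[of _ F]) auto
  next
    case False
    then obtain H where H: "cover H" "card H < card F" "weight H \<le> weight F + 4 * card F"
      using shrink_cover[OF less.prems(1)] assms(1) by (meson le_less_trans not_le)
    then obtain F' where F': "cover F'" "card F' \<le> a" "weight F' \<le> weight H + 8 * a * (card H - a)"
      using less.hyps[of H] less.prems by auto
    \<comment> \<open>As \<open>card F \<le> 2 * a\<close>, the step costs at most
      \<open>8 * a\<close>, which is paid for by the decrease of \<open>card F - a\<close> by at
      least one.\<close>
    have "card F - a = Suc (card F - a - 1)" "card H - a \<le> card F - a - 1" using False H(2) by auto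
    then have "8 * a * (card H - a) + 8 * a \<le> 8 * a * (card F - a)"
      by (metis add.commute mult_Suc_right mult_le_mono2 nat_add_left_cancel_le)
    then have "weight F' \<le> weight F + 8 * a * (card F - a)"
      using F'(3) H(3) less.prems(2) by linarith
    then show ?thesis using F' by blast
  qed
qed

text \<open>By maximality each vertex lies in \<open>X\<close> or is adjacent to a vertex of
  \<open>X\<close>, so the red and blue stars centred in \<open>X\<close> cover. Each has diameter
  at most \<open>2\<close>, hence weight \<open>3\<close>.\<close>

lemma star_cover:
  assumes X: "indep X" and max: "\<And>Y. indep Y \<Longrightarrow> card Y \<le> card X"
  shows "\<exists>F. cover F \<and> card F \<le> 2 * card X \<and> weight F \<le> 6 * card X"
proof (intro exI conjI)
  let ?F = "(\<lambda>p. (fst p, nbhd (E (fst p)) {snd p}, 2::nat)) ` ({Red, Blue} \<times> X)"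
  have XV: "X \<subseteq> V" and finX: "finite X"
    using X finite_V finite_subset unfolding indep_def by blast+
  have members: "D \<subseteq> V \<and> diam_le (E k) D d" if mem: "(k, D, d) \<in> ?F" for k D d
  proof -
    obtain x where "x \<in> X" "D = nbhd (E k) {x}" "d = 2" using mem by auto
    then show ?thesis
      using nbhd_subset_V[of "{x}"] XV diam_le_nbhd[OF sym_E diam_le_singleton]
      by (auto simp: eval_nat_numeral)
  qed
  have covered: "\<exists>(k, D, d)\<in>?F. v \<in> D" if v: "v \<in> V" for v
  proof -
    have "\<exists>x\<in>X. \<exists>k. v \<in> nbhd (E k) {x}"
    proof (rule ccontr)
      assume none: "\<not> ?thesis"
      then have nb: "v \<noteq> x" "(x, v) \<notin> E k" "(v, x) \<notin> E k" if "x \<in> X" for x k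
        using that sym_E[of k] unfolding nbhd_def by (auto dest: symD)
      then have "indep (insert v X)"
        using X v irrefl_E unfolding indep_def by auto
      moreover have "v \<notin> X" using nb(1) by blast
      ultimately show False using max[of "insert v X"] finX by simp
    qed
    then obtain x k where "x \<in> X" "v \<in> nbhd (E k) {x}" by blast
    then show ?thesis
      by (intro bexI[of _ "(k, nbhd (E k) {x}, 2)"]) (cases k; force)+
  qed
  show "cover ?F"
    by (rule coverI[OF _ members covered]) (use finX in blast)
  have two: "card ({Red, Blue} \<times> X) = 2 * card X" by (simp add: card_cartesian_product)
  show "card ?F \<le> 2 * card X"
    by (rule order_trans[OF card_image_le]) (use finX two in auto)
  show "weight ?F \<le> 6 * card X"
    using weight_image_le[of "{Red, Blue} \<times> X" fst _ "\<lambda>_. 2"] finX two by simp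
qed

text \<open>The stars weigh at most \<open>6 * card X\<close>, and at most \<open>card X\<close>
  reductions add at most \<open>8 * card X\<close> each. A single diameter is bounded by the total
  weight.\<close>

lemma small_cover:
  assumes "indep X" and "\<And>Y. indep Y \<Longrightarrow> card Y \<le> card X"
  shows "\<exists>F. cover F \<and> card F \<le> card X \<and>
    (\<forall>(k, D, d)\<in>F. d \<le> 8 * (card X)\<^sup>2 + 6 * card X)"
proof -
  obtain F0 where F0: "cover F0" "card F0 \<le> 2 * card X" "weight F0 \<le> 6 * card X"
    using star_cover[OF assms] by blast
  obtain F where F: "cover F" "card F \<le> card X"
    "weight F \<le> weight F0 + 8 * card X * (card F0 - card X)"
    using shrink_cover_to[OF assms(2) F0(1,2)] by blast
  have "8 * card X * (card F0 - card X) \<le> 8 * card X * card X"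
    using F0(2) by (intro mult_le_mono2) auto
  then have w: "weight F \<le> 8 * (card X)\<^sup>2 + 6 * card X"
    using F(3) F0(3) unfolding power2_eq_square by linarith
  have "d \<le> weight F" if "(k, D, d) \<in> F" for k D d
    using member_le_sum[of "(k, D, d)" F "\<lambda>(k, D, d). d + 1"] that coverD(1)[OF F(1)]
    unfolding weight_def by auto
  then show ?thesis using F w by (intro exI[of _ F]) (fastforce intro: order_trans)
qed

end

section \<open>Diameters of monochromatic subgraphs\<close>

text \<open>Links relation powers to the walks of the library. The assumption on \<open>u\<close>
  serves the empty walk, which must start at a vertex.\<close>

lemma relpow_imp_awalk:
  assumes "wf_digraph (with_proj H)" "(u, v) \<in> parcs H ^^ n" "u \<in> pverts H"
  shows "\<exists>p. pre_digraph.awalk (with_proj H) u p v \<and> length p = n"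
  using assms(2,3)
proof (induction n arbitrary: u)
  case 0
  then show ?case using wf_digraph.awalk_Nil_iff[OF assms(1)] by auto
next
  case (Suc n)
  then obtain w where w: "(u, w) \<in> parcs H" "(w, v) \<in> parcs H ^^ n" by (meson relpow_Suc_D2)
  then have "w \<in> pverts H" using wf_digraph.head_in_verts[OF assms(1), of "(u, w)"] by simp
  then obtain p where "pre_digraph.awalk (with_proj H) w p v" "length p = n"
    using Suc.IH w by blast
  then show ?case using wf_digraph.awalk_Cons_iff[OF assms(1), of u "(u, w)" p v] w
    by (intro exI[of _ "(u, w) # p"]) auto
qed

text \<open>With unit weights a walk costs its length, and the distance is at most the cost of any
  walk.\<close>

lemma graph_diameter_le:
  assumes wf: "wf_digraph (with_proj H)" and diam: "diam_le (parcs H) (pverts H) d"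
  shows "graph_diameter H \<le> ereal (real d)"
  unfolding graph_diameter_def
proof (intro SUP_least)
  fix u v assume uv: "u \<in> pverts H" "v \<in> pverts H"
  \<comment> \<open>Arcs of a well-formed digraph join vertices, so the restriction in
    \<open>diam_le\<close> changes nothing here.\<close>
  have "parcs H \<inter> pverts H \<times> pverts H = parcs H"
    using wf_digraph.tail_in_verts[OF wf] wf_digraph.head_in_verts[OF wf] by fastforce
  then obtain n where n: "n \<le> d" "(u, v) \<in> parcs H ^^ n"
    using diam uv unfolding diam_le_def by metis
  then obtain p where p: "pre_digraph.awalk (with_proj H) u p v" "length p = n"
    using relpow_imp_awalk[OF wf] uv by blast
  have "wf_digraph.awalk_cost (\<lambda>_. 1) p = real (length p)" for p :: "('a \<times> 'a) list"
    unfolding wf_digraph.awalk_cost_def[OF wf] by (induction p) auto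
  then show "graph_dist H u v \<le> ereal (real d)"
    unfolding graph_dist_def using wf_digraph.min_cost_le_walk_cost[OF wf p(1), of "\<lambda>_. 1"] p(2) n(1)
    by (auto intro: order_trans)
qed

section \<open>Transfer to edge-coloured graphs\<close>

theorem theorem3:
  fixes G :: "'a pair_pre_digraph" and c :: "'a set \<Rightarrow> colour"
  assumes "pair_graph G"
  shows "\<exists>S. finite S \<and> card S \<le> independence_number G \<and> covering_set c S G \<and>
    (\<forall>H\<in>S. graph_diameter H \<le>
       ereal (real (8 * (independence_number G)\<^sup>2 + 12 * independence_number G + 4)))"
proof -
  interpret pair_graph G by fact
  define E where "E = (\<lambda>k. {(u, v) \<in> parcs G. c {u, v} = k})"
  have symG: "(v, u) \<in> parcs G" if "(u, v) \<in> parcs G" for u v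
    using that pair_sym_arcs unfolding symmetric_def sym_def by auto
  interpret coloured_graph "pverts G" E
  proof
    show "finite (pverts G)" by (rule pair_finite_verts)
    show "E k \<subseteq> pverts G \<times> pverts G" for k
      unfolding E_def using in_arcsD1 in_arcsD2 by auto
    show "sym (E k)" for k
      unfolding E_def sym_def using symG by (auto simp: insert_commute)
    show "(x, x) \<notin> E k" for x k
      unfolding E_def using pair_no_loops by fastforce
  qed
  \<comment> \<open>Every arc has a colour, so avoiding the arcs of each colour means avoiding all
    arcs.\<close>
  have indep_iff: "independent_set G X \<longleftrightarrow> indep X" for X
    unfolding independent_set_def indep_def by (auto simp: E_def)
  let ?a = "independence_number G"
  let ?A = "card ` {X. indep X}"
  have a: "?a = Max ?A" unfolding independence_number_def indep_iff ..
  have "{X. indep X} \<subseteq> Pow (pverts G)" unfolding indep_def by blast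
  then have fin: "finite ?A" using pair_finite_verts by (meson finite_Pow_iff finite_imageI finite_subset)
  \<comment> \<open>The maximum is attained because the set of sizes is finite and, by the empty
    set, nonempty.\<close>
  have "indep {}" unfolding indep_def by blast
  then have "?A \<noteq> {}" by blast
  from Max_in[OF fin this] obtain X where X: "indep X" "card X = ?a" unfolding a by auto
  have "card Y \<le> card X" if "indep Y" for Y
    unfolding X(2) a using fin that by (intro Max_ge) auto
  from small_cover[OF X(1) this] obtain F where F: "cover F" "card F \<le> ?a"
    and d: "\<forall>(k, D, d)\<in>F. d \<le> 8 * ?a\<^sup>2 + 6 * ?a"
    unfolding X(2) by blast
  \<comment> \<open>The subgraph on \<open>D\<close> takes all edges of colour \<open>k\<close>
    inside \<open>D\<close>, the relation used in \<open>diam_le\<close>. Forgetting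
    \<open>d\<close> may identify triples, which only lowers the number of subgraphs.\<close>
  define mk where "mk = (\<lambda>(k, D, d::nat). \<lparr>pverts = D, parcs = E k \<inter> D \<times> D\<rparr>)"
  have mono: "monochromatic_subgraph c (mk (k, D, d)) G"
    and diam: "graph_diameter (mk (k, D, d)) \<le> ereal (real (8 * ?a\<^sup>2 + 12 * ?a + 4))"
    if mem: "(k, D, d) \<in> F" for k D d
  proof -
    let ?H = "mk (k, D, d)"
    have H: "pverts ?H = D" "parcs ?H = E k \<inter> D \<times> D" unfolding mk_def by auto
    have D: "D \<subseteq> pverts G" "diam_le (E k) D d" using coverD[OF F(1)] mem by blast+
    have EG: "E k \<subseteq> parcs G" unfolding E_def by auto
    have pg: "pair_graph ?H"
    proof
      show "finite (pverts ?H)" "finite (parcs ?H)"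
        using H finite_subset[OF D(1) pair_finite_verts] finite_E by auto
      show "symmetric (with_proj ?H)"
        unfolding symmetric_def with_proj_simps H using sym_E[of k] unfolding sym_def by auto
      show "fst e \<noteq> snd e" if "e \<in> parcs ?H" for e
        using that irrefl_E unfolding H by (metis IntD1 prod.collapse)
    qed (auto simp: H)
    then interpret H: pair_graph ?H .
    have wf: "wf_digraph (with_proj ?H)" by (rule H.wf_digraph_axioms)
    have "subgraph (with_proj ?H) (with_proj G)"
      unfolding subgraph_def compatible_def using H D(1) EG wf wf_digraph_axioms by auto
    then show "monochromatic_subgraph c ?H G"
      unfolding monochromatic_subgraph_def using pg H unfolding E_def by auto
    have "diam_le (parcs ?H) (pverts ?H) d" using D(2) unfolding H diam_le_def by (simp add: Int_assoc)
    from graph_diameter_le[OF wf this]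
    have "graph_diameter ?H \<le> ereal (real d)" .
    \<comment> \<open>The bound \<open>8 * ?a\<^sup>2 + 6 * ?a\<close> from the total weight lies
      below the required one.\<close>
    also have "d \<le> 8 * ?a\<^sup>2 + 12 * ?a + 4"
      using bspec[OF d mem] by simp
    then have "ereal (real d) \<le> ereal (real (8 * ?a\<^sup>2 + 12 * ?a + 4))"
      by (simp only: ereal_less_eq(3) of_nat_le_iff)
    finally show "graph_diameter ?H \<le> ereal (real (8 * ?a\<^sup>2 + 12 * ?a + 4))" .
  qed
  show ?thesis
  proof (intro exI[of _ "mk ` F"] conjI)
    show "finite (mk ` F)" using coverD(1)[OF F(1)] by blast
    show "card (mk ` F) \<le> ?a" using card_image_le[OF coverD(1)[OF F(1)], of mk] F(2) by linarith
    have "pverts G \<subseteq> (\<Union>H\<in>mk ` F. pverts H)"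
    proof
      fix v assume "v \<in> pverts G"
      then obtain k D e where "(k, D, e) \<in> F" "v \<in> D" using coverD(4)[OF F(1)] by blast
      then show "v \<in> (\<Union>H\<in>mk ` F. pverts H)" by (force simp: mk_def)
    qed
    then show "covering_set c (mk ` F) G" unfolding covering_set_def using mono by auto
    show "\<forall>H\<in>mk ` F. graph_diameter H \<le> ereal (real (8 * ?a\<^sup>2 + 12 * ?a + 4))"
      using diam by auto
  qed
qed

end
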